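(* Let $n\geq 1$. For every $k\in\mathbb{Z}$, the $k$-power map $\rho_k:S(\mathbb{A}_n)\to S(\mathbb{A}_n)$, $\rho_k(x)=x^k$, has topological degree $k$.
   Context: The Cayley-Dickson algebras $\mathbb{A}_n=\mathbb{R}^{2^n}$ are defined by $\mathbb{A}_0=\mathbb{R}$ with $\overline{x}=x$, and $\mathbb{A}_{n+1}=\mathbb{A}_n\times\mathbb{A}_n$ with product $(a,b)(x,y)=(ax-\overline{y}b,\;ya+b\overline{x})$ and conjugation $\overline{(x_1,x_2)}=(\overline{x_1},-x_2)$. The first canonical basis vector $e_0$ is the unit. $S(\mathbb{A}_n)=S^{2^n-1}$ is the unit sphere of $\mathbb{A}_n$ for the Euclidean norm $\|\cdot\|$ of $\mathbb{R}^{2^n}$. Powers: $x^0=e_0$, $x^{m+1}=x^m x$ for $m\ge 0$ (the algebras are power-associative); for $x\neq 0$, $x^{-1}=\|x\|^{-2}\overline{x}$ and $x^{-k}=(x^{-1})^k$ for $k>0$. The map $\rho_k$ sends the unit sphere to itself. *)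

theory Defs
  imports "HOL-Analysis.Analysis" "HOL-Homology.Homology"
begin

text \<open>
  Elements of the Cayley-Dickson algebra \<open>A\<^sub>n = \<real>\<^bsup>2^n\<^esup>\<close> are represented, as in
  \<^const>\<open>Euclidean_space\<close>, by sequences vanishing from index \<open>2 ^ n\<close> on; the dimension has to be
  a term rather than a type because the algebras are defined by recursion on \<open>n\<close>.
  The identification of \<open>A\<^bsub>n+1\<^esub>\<close> with \<open>A\<^sub>n \<times> A\<^sub>n\<close> is by concatenation of coordinates.
\<close>

definition cd_fst :: "nat \<Rightarrow> (nat \<Rightarrow> real) \<Rightarrow> nat \<Rightarrow> real" where
  "cd_fst n x = (\<lambda>i. if i < 2 ^ n then x i else 0)"

definition cd_snd :: "nat \<Rightarrow> (nat \<Rightarrow> real) \<Rightarrow> nat \<Rightarrow> real" where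
  "cd_snd n x = (\<lambda>i. if i < 2 ^ n then x (2 ^ n + i) else 0)"

definition cd_pair :: "nat \<Rightarrow> (nat \<Rightarrow> real) \<Rightarrow> (nat \<Rightarrow> real) \<Rightarrow> nat \<Rightarrow> real" where
  "cd_pair n a b =
     (\<lambda>i. if i < 2 ^ n then a i else if i < 2 ^ Suc n then b (i - 2 ^ n) else 0)"

primrec cd_conj :: "nat \<Rightarrow> (nat \<Rightarrow> real) \<Rightarrow> nat \<Rightarrow> real" where
  "cd_conj 0 x = x"
| "cd_conj (Suc n) x = cd_pair n (cd_conj n (cd_fst n x)) (\<lambda>i. - cd_snd n x i)"

primrec cd_mult :: "nat \<Rightarrow> (nat \<Rightarrow> real) \<Rightarrow> (nat \<Rightarrow> real) \<Rightarrow> nat \<Rightarrow> real" where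
  "cd_mult 0 v w = (\<lambda>i. if i = 0 then v 0 * w 0 else 0)"
| "cd_mult (Suc n) v w =
     (let a = cd_fst n v; b = cd_snd n v; x = cd_fst n w; y = cd_snd n w in
      cd_pair n
        (\<lambda>i. cd_mult n a x i - cd_mult n (cd_conj n y) b i)
        (\<lambda>i. cd_mult n y a i + cd_mult n b (cd_conj n x) i))"

definition cd_one :: "nat \<Rightarrow> real" where
  "cd_one = (\<lambda>i. if i = 0 then 1 else 0)"

definition cd_norm :: "nat \<Rightarrow> (nat \<Rightarrow> real) \<Rightarrow> real" where
  "cd_norm n x = L2_set x {..<2 ^ n}"

primrec cd_pow :: "nat \<Rightarrow> (nat \<Rightarrow> real) \<Rightarrow> nat \<Rightarrow> nat \<Rightarrow> real" where
  "cd_pow n x 0 = cd_one"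
| "cd_pow n x (Suc m) = cd_mult n (cd_pow n x m) x"

definition cd_inverse :: "nat \<Rightarrow> (nat \<Rightarrow> real) \<Rightarrow> nat \<Rightarrow> real" where
  "cd_inverse n x = (\<lambda>i. inverse ((cd_norm n x)\<^sup>2) * cd_conj n x i)"

definition cd_power_int :: "nat \<Rightarrow> (nat \<Rightarrow> real) \<Rightarrow> int \<Rightarrow> nat \<Rightarrow> real" where
  "cd_power_int n x k =
     (if k \<ge> 0 then cd_pow n x (nat k) else cd_pow n (cd_inverse n x) (nat (- k)))"

definition cd_rho :: "nat \<Rightarrow> int \<Rightarrow> (nat \<Rightarrow> real) \<Rightarrow> nat \<Rightarrow> real" where
  "cd_rho n k = (\<lambda>x. cd_power_int n x k)"

text \<open>\<^term>\<open>nsphere p\<close> is the unit sphere of dimension \<open>p\<close>, that is, of \<open>\<real>\<^bsup>p+1\<^esup>\<close>.\<close>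

abbreviation cd_sphere :: "nat \<Rightarrow> (nat \<Rightarrow> real) topology" where
  "cd_sphere n \<equiv> nsphere (2 ^ n - 1)"

lemma topspace_cd_sphere:
  "topspace (cd_sphere n) = {x \<in> topspace (Euclidean_space (2 ^ n)). cd_norm n x = 1}"
proof -
  have "{..2 ^ n - 1} = {..<2 ^ n::nat}"
    by (metis Suc_pred' lessThan_Suc_atMost pos2 zero_less_power)
  moreover have "Suc (2 ^ n - 1) = 2 ^ n"
    by simp
  ultimately show ?thesis
    by (auto simp: nsphere_def cd_norm_def L2_set_def)
qed

end

(* On the plane spanned by the unit e0 and x, the product is that of the complex numbers, so
   x = cos t e0 + sin t u (u imaginary, 0 <= t <= pi) has k-th power cos (k t) e0 + sin (k t) u:
   the power map multiplies the polar angle t by k.  Up to homotopy, a map that acts on the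
   polar angle depends only on its values m pi and l pi at the two poles.  Making the angle
   function pass through a multiple of pi at the equator collapses the equator to a point, so
   degrees add along concatenation of angle functions.  A shift of the angle by pi is
   composition with the antipodal map, which on an odd-dimensional sphere is homotopic to the
   identity.  Hence the degree for (0, k + 1) is that for (0, 1), the identity, plus that
   for (0, k). *)
theory Submission
  imports Defs
begin

subsection \<open>Maps that factor through a pinch of the sphere\<close>

text \<open>Composing induced maps requires knowing where a whole set is sent, but a map of the
  sphere is controlled only on the sphere. These two lemmas exchange a set for its trace
  there.\<close>

lemma hom_induced_restrict_source:
  "hom_induced p X (topspace X \<inter> S) Y T = hom_induced p X S Y T"
  by (metis hom_induced_restrict inf.left_idem)

lemma hom_induced_restrict_target:
  "hom_induced p X S Y (topspace Y \<inter> T) = hom_induced p X S Y T"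
  by (metis hom_induced_restrict inf.left_idem)

text \<open>The homology relative to the equator is the sum of the contributions of the two
  hemispheres, and each of \<open>f\<close> and \<open>g\<close> kills one of them in the homology relative to \<open>a\<close>.\<close>

lemma Brouwer_degree2_pinch:
  assumes cf: "continuous_map (nsphere p) (nsphere p) f"
    and cg: "continuous_map (nsphere p) (nsphere p) g"
    and ch: "continuous_map (nsphere p) (nsphere p) h"
    and hf: "\<And>x. x \<in> topspace (nsphere p) \<Longrightarrow> x k \<ge> 0 \<Longrightarrow> h x = f x"
    and hg: "\<And>x. x \<in> topspace (nsphere p) \<Longrightarrow> x k \<le> 0 \<Longrightarrow> h x = g x"
    and fa: "\<And>x. x \<in> topspace (nsphere p) \<Longrightarrow> x k \<le> 0 \<Longrightarrow> f x = a"
    and ga: "\<And>x. x \<in> topspace (nsphere p) \<Longrightarrow> x k \<ge> 0 \<Longrightarrow> g x = a"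
    and a: "a \<in> topspace (nsphere p)"
  shows "Brouwer_degree2 p h = Brouwer_degree2 p f + Brouwer_degree2 p g"
proof (rule Brouwer_degree2_unique [OF ch])
  let ?S = "nsphere p"
  define U where "U = {x::nat\<Rightarrow>real. x k \<ge> 0}"
  define L where "L = {x::nat\<Rightarrow>real. x k \<le> 0}"
  define E where "E = {x::nat\<Rightarrow>real. x k = 0}"
  have EL: "E \<subseteq> L" and EU: "E \<subseteq> U"
    by (auto simp: U_def L_def E_def)
  let ?RL = "relative_homology_group p (subtopology ?S L) E"
  let ?RU = "relative_homology_group p (subtopology ?S U) E"
  let ?RE = "relative_homology_group p ?S E"
  let ?RA = "relative_homology_group p ?S {a}"
  let ?G = "reduced_homology_group p ?S"
  let ?iL = "hom_induced p (subtopology ?S L) E ?S E id"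
  let ?iU = "hom_induced p (subtopology ?S U) E ?S E id"
  let ?j = "hom_induced p ?S {} ?S E id"
  let ?ja = "hom_induced p ?S {} ?S {a} id"
  \<comment> \<open>\<open>?RL\<close> and \<open>?RU\<close> map isomorphically onto the homology
    of the sphere relative to \<open>U\<close> and to \<open>L\<close>. With the exact sequences of
    the two triples, these isomorphisms split \<open>?RE\<close> as a direct sum.\<close>
  have sum: "(\<lambda>(x, y). ?iL x \<otimes>\<^bsub>?RE\<^esub> ?iU y) \<in> Group.iso (?RL \<times>\<times> ?RU) ?RE"
  proof (rule conjunct1 [OF exact_sequence_sum_lemma [OF abelian_relative_homology_group]])
    show "hom_induced p (subtopology ?S L) E ?S U id \<in> Group.iso ?RL (relative_homology_group p ?S U)"
      unfolding U_def L_def E_def by (rule iso_relative_homology_group_lower_hemisphere)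
    show "hom_induced p (subtopology ?S U) E ?S L id \<in> Group.iso ?RU (relative_homology_group p ?S L)"
      unfolding U_def L_def E_def by (rule iso_relative_homology_group_upper_hemisphere)
    show "exact_seq ([relative_homology_group p ?S L, ?RE, ?RL], [hom_induced p ?S E ?S L id, ?iL])"
      by (rule homology_exactness_triple_3 [OF EL])
    show "exact_seq ([relative_homology_group p ?S U, ?RE, ?RU], [hom_induced p ?S E ?S U id, ?iU])"
      by (rule homology_exactness_triple_3 [OF EU])
  next
    fix x
    show "hom_induced p ?S E ?S U id (?iL x) = hom_induced p (subtopology ?S L) E ?S U id x"
      using EU by (subst hom_induced_compose') auto
    show "hom_induced p ?S E ?S L id (?iU x) = hom_induced p (subtopology ?S U) E ?S L id x"
      using EL by (subst hom_induced_compose') auto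
  qed
  interpret RA: comm_group ?RA by simp
  have sub: "continuous_map (subtopology ?S T) ?S q" if "continuous_map ?S ?S q" for q T
    using that by (rule continuous_map_from_subtopology)
  \<comment> \<open>A map that is constantly \<open>a\<close> on \<open>T\<close> factors through
    the pair (\<open>{a}\<close>, \<open>{a}\<close>), whose relative homology is trivial.\<close>
  have const: "hom_induced p (subtopology ?S T) E ?S {a} q c = \<one>\<^bsub>?RA\<^esub>"
    if q: "continuous_map ?S ?S q" and qa: "\<And>x. x \<in> topspace ?S \<Longrightarrow> x \<in> T \<Longrightarrow> q x = a" 
    for q T c
  proof -
    let ?A = "subtopology ?S {a}"
    let ?X = "subtopology ?S T"
    let ?E = "topspace ?X \<inter> E"
    have ta: "topspace ?A = {a}" using a by auto
    have 1: "continuous_map ?X ?A q"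
      using sub [OF q] qa by (auto simp: continuous_map_in_subtopology)
    have 2: "q \<in> ?E \<rightarrow> {a}"
      using qa by auto
    have "hom_induced p ?X E ?S {a} q c = hom_induced p ?X ?E ?S {a} (id \<circ> q) c"
      by (simp only: hom_induced_restrict_source id_comp)
    also have "\<dots> = hom_induced p ?A {a} ?S {a} id (hom_induced p ?X ?E ?A {a} q c)"
      by (rule hom_induced_compose' [symmetric, OF 1 2]) auto
    also have "hom_induced p ?X ?E ?A {a} q c = \<one>\<^bsub>relative_homology_group p ?A {a}\<^esub>"
      using trivial_relative_homology_group_topspace [of p ?A] hom_induced_carrier
      unfolding ta trivial_group_def by fastforce
    also have "hom_induced p ?A {a} ?S {a} id \<dots> = \<one>\<^bsub>?RA\<^esub>"
      by (rule hom_one [OF hom_induced_hom]) auto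
    finally show ?thesis .
  qed
  \<comment> \<open>The components \<open>u\<close> and \<open>v\<close> are chosen from
    \<open>c\<close> before \<open>q\<close>, so the same pair serves \<open>f\<close>,
    \<open>g\<close> and \<open>h\<close>.\<close>
  have split: "\<exists>u v. u \<in> carrier ?RL \<and> v \<in> carrier ?RU \<and> (\<forall>q. continuous_map ?S ?S q \<longrightarrow>
      (\<forall>x \<in> topspace ?S. x k = 0 \<longrightarrow> q x = a) \<longrightarrow>
      ?ja (hom_induced p ?S {} ?S {} q c) =
      hom_induced p (subtopology ?S L) E ?S {a} q u \<otimes>\<^bsub>?RA\<^esub> hom_induced p (subtopology ?S U) E ?S {a} q v)"
    for c
  proof -
    have "?j c \<in> carrier ?RE" by (rule hom_induced_carrier)
    then have "?j c \<in> (\<lambda>(x, y). ?iL x \<otimes>\<^bsub>?RE\<^esub> ?iU y) ` carrier (?RL \<times>\<times> ?RU)"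
      using sum by (simp add: iso_iff)
    then obtain u v where u: "u \<in> carrier ?RL" and v: "v \<in> carrier ?RU"
      and uv: "?j c = ?iL u \<otimes>\<^bsub>?RE\<^esub> ?iU v"
      by auto
    have "?ja (hom_induced p ?S {} ?S {} q c) =
      hom_induced p (subtopology ?S L) E ?S {a} q u \<otimes>\<^bsub>?RA\<^esub> hom_induced p (subtopology ?S U) E ?S {a} q v"
      if q: "continuous_map ?S ?S q" and qE: "\<forall>x \<in> topspace ?S. x k = 0 \<longrightarrow> q x = a" for q
    proof -
      let ?E = "topspace ?S \<inter> E"
      let ?q = "hom_induced p ?S ?E ?S {a} q"
      have q': "q \<in> ?E \<rightarrow> {a}" using qE by (auto simp: E_def)
      have qq: "?q (hom_induced p (subtopology ?S T) E ?S E id w) = hom_induced p (subtopology ?S T) E ?S {a} q w" for T w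
      proof -
        let ?ET = "topspace (subtopology ?S T) \<inter> E"
        have "?q (hom_induced p (subtopology ?S T) E ?S E id w) 
            = ?q (hom_induced p (subtopology ?S T) ?ET ?S ?E id w)"
          by (simp only: hom_induced_restrict)
        also have "\<dots> = hom_induced p (subtopology ?S T) ?ET ?S {a} (q \<circ> id) w"
          by (rule hom_induced_compose' [OF _ _ q q']) auto
        finally show ?thesis
          by (simp only: comp_id hom_induced_restrict_source)
      qed
      have "?ja (hom_induced p ?S {} ?S {} q c) = hom_induced p ?S {} ?S {a} (id \<circ> q) c"
        by (rule hom_induced_compose' [OF q]) auto
      also have "\<dots> = hom_induced p ?S {} ?S {a} (q \<circ> id) c"
        by simp
      also have "\<dots> = ?q (hom_induced p ?S {} ?S ?E id c)"
        by (rule hom_induced_compose' [symmetric, OF _ _ q q']) auto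
      also have "hom_induced p ?S {} ?S ?E id c = ?j c"
        by (simp only: hom_induced_restrict_target)
      also have "?q (?j c) = ?q (?iL u) \<otimes>\<^bsub>?RA\<^esub> ?q (?iU v)"
        unfolding uv
        by (rule hom_mult [of _ ?RE])
           (use hom_induced_hom [of p ?S ?E ?S "{a}" q] hom_induced_carrier in auto)
      finally show ?thesis
        by (simp only: qq)
    qed
    then show ?thesis
      using u v by blast
  qed
  \<comment> \<open>A point is contractible, so \<open>?ja\<close> is injective and an identity
    relative to \<open>a\<close> carries back to reduced homology.\<close>
  have ja: "?ja \<in> Group.iso ?G ?RA"
    using a by (intro iso_reduced_homology_by_contractible)
      (auto simp: contractible_space_subtopology_singleton)
  fix c
  assume c: "c \<in> carrier ?G"
  interpret G: group ?G by simp
  let ?h = "\<lambda>q. hom_induced p ?S {} ?S {} q c"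
  obtain u v where uv: "\<And>q. continuous_map ?S ?S q \<Longrightarrow>
      (\<forall>x \<in> topspace ?S. x k = 0 \<longrightarrow> q x = a) \<Longrightarrow> ?ja (?h q) =
      hom_induced p (subtopology ?S L) E ?S {a} q u \<otimes>\<^bsub>?RA\<^esub> hom_induced p (subtopology ?S U) E ?S {a} q v"
    using split [of c] by blast
  have "?ja (?h f) = hom_induced p (subtopology ?S U) E ?S {a} f v"
    using const [OF cf, of L] fa by (simp add: uv cf L_def hom_induced_carrier
        del: one_relative_homology_group)
  moreover have "?ja (?h g) = hom_induced p (subtopology ?S L) E ?S {a} g u"
    using const [OF cg, of U] ga by (simp add: uv cg U_def hom_induced_carrier
        del: one_relative_homology_group)
  moreover have "?ja (?h h) =
      hom_induced p (subtopology ?S L) E ?S {a} h u \<otimes>\<^bsub>?RA\<^esub> hom_induced p (subtopology ?S U) E ?S {a} h v"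
    by (rule uv) (use ch hf fa in auto)
  \<comment> \<open>\<open>h\<close> takes its lower component from \<open>g\<close> and its upper
    one from \<open>f\<close>, which are exactly the components that survive.\<close>
  moreover have "hom_induced p (subtopology ?S L) E ?S {a} h = hom_induced p (subtopology ?S L) E ?S {a} g"
    by (rule hom_induced_eq) (auto simp: hg L_def)
  moreover have "hom_induced p (subtopology ?S U) E ?S {a} h = hom_induced p (subtopology ?S U) E ?S {a} f"
    by (rule hom_induced_eq) (auto simp: hf U_def)
  ultimately have "?ja (?h h) = ?ja (?h f) \<otimes>\<^bsub>?RA\<^esub> ?ja (?h g)"
    by (simp add: RA.m_comm hom_induced_carrier)
  moreover have car: "?h q \<in> carrier ?G" for q
    using c by (rule hom_induced_reduced)
  moreover have "?ja (?h f \<otimes>\<^bsub>?G\<^esub> ?h g) = ?ja (?h f) \<otimes>\<^bsub>?RA\<^esub> ?ja (?h g)"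
    using ja car by (intro hom_mult) (simp_all only: iso_iff)
  ultimately have "?ja (?h h) = ?ja (?h f \<otimes>\<^bsub>?G\<^esub> ?h g)"
    by metis
  then have "?h h = ?h f \<otimes>\<^bsub>?G\<^esub> ?h g"
    using ja car by (auto simp: iso_iff dest: inj_onD)
  also have "\<dots> = c [^]\<^bsub>?G\<^esub> (Brouwer_degree2 p f + Brouwer_degree2 p g)"
    by (simp add: Brouwer_degree2 c G.int_pow_mult)
  finally show "?h h = c [^]\<^bsub>?G\<^esub> (Brouwer_degree2 p f + Brouwer_degree2 p g)" .
qed

subsection \<open>Maps that act on the polar angle\<close>

text \<open>The direction of \<open>x\<close> off the first axis is undefined at the poles, where the division yields
  \<open>0\<close>; the value is therefore on the sphere only if \<open>sin a = 0\<close> there.\<close>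

definition polar :: "real \<Rightarrow> (nat \<Rightarrow> real) \<Rightarrow> nat \<Rightarrow> real" where
  "polar a x = (\<lambda>i. if i = 0 then cos a else sin a * (x i / sin (arccos (x 0))))"

lemma topspace_nsphere:
  "topspace (nsphere p) = {x. (\<Sum>i\<le>p. (x i)\<^sup>2) = 1 \<and> (\<forall>i>p. x i = 0)}"
  by (auto simp: nsphere)

lemma nsphere_abs_le_1:
  assumes "x \<in> topspace (nsphere p)"
  shows "\<bar>x i\<bar> \<le> 1"
  using topspace_nsphere_1 [OF assms, of i] by (simp add: abs_square_le_1)

text \<open>\<open>sin (arccos (x 0))\<close> is the length of the part of \<open>x\<close>
  orthogonal to the first axis. The bound controls the quotients in \<open>polar\<close> and makes
  the other coordinates vanish at the poles.\<close>

lemma nsphere_abs_le_sin: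
  assumes "x \<in> topspace (nsphere p)" "i \<noteq> 0"
  shows "\<bar>x i\<bar> \<le> sin (arccos (x 0))"
proof -
  have "(x 0)\<^sup>2 + (x i)\<^sup>2 \<le> 1"
  proof (cases "i \<le> p")
    case True
    have "(\<Sum>j\<in>{0,i}. (x j)\<^sup>2) \<le> (\<Sum>j\<le>p. (x j)\<^sup>2)"
      using True by (intro sum_mono2) auto
    then show ?thesis
      using assms by (simp add: topspace_nsphere)
  next
    case False
    then show ?thesis
      using assms topspace_nsphere_1 [OF assms(1), of 0] by (simp add: topspace_nsphere)
  qed
  then have "\<bar>x i\<bar> \<le> sqrt (1 - (x 0)\<^sup>2)"
    by (simp add: real_le_rsqrt)
  then show ?thesis
    using nsphere_abs_le_1 [OF assms(1), of 0] by (simp add: sin_arccos_abs)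
qed

text \<open>Near a zero of \<open>s\<close> the quotient \<open>u x / s x\<close> need not converge,
  but it stays bounded by 1 while \<open>r\<close> tends to 0.\<close>

lemma continuous_map_mult_divide_bounded:
  assumes r: "continuous_map X euclideanreal r" and u: "continuous_map X euclideanreal u"
    and s: "continuous_map X euclideanreal s"
    and us: "\<And>x. x \<in> topspace X \<Longrightarrow> \<bar>u x\<bar> \<le> \<bar>s x\<bar>"
    and rs: "\<And>x. x \<in> topspace X \<Longrightarrow> s x = 0 \<Longrightarrow> r x = 0"
  shows "continuous_map X euclideanreal (\<lambda>x. r x * (u x / s x))"
  unfolding continuous_map_atin limitin_canonical_iff
proof
  fix z assume z: "z \<in> topspace X"
  have lim: "tendsto r (r z) (atin X z)" "tendsto u (u z) (atin X z)" "tendsto s (s z) (atin X z)"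
    using r u s z by (simp_all add: continuous_map_atin)
  show "tendsto (\<lambda>x. r x * (u x / s x)) (r z * (u z / s z)) (atin X z)"
  proof (cases "s z = 0")
    case False
    with lim show ?thesis by (intro tendsto_intros)
  next
    case True
    have "\<forall>\<^sub>F x in atin X z. norm (r x * (u x / s x)) \<le> norm (r x)"
      unfolding eventually_atin
    proof (intro disjI2 exI conjI ballI)
      fix x assume "x \<in> topspace X - {z}"
      then have "\<bar>u x / s x\<bar> \<le> 1"
        using us [of x] by (auto simp: abs_divide divide_le_eq_1)
      then show "norm (r x * (u x / s x)) \<le> norm (r x)"
        using mult_left_mono [of "\<bar>u x / s x\<bar>" 1 "\<bar>r x\<bar>"] by (simp only: real_norm_def abs_mult) simp
    qed (use z in auto)
    moreover have "tendsto (\<lambda>x. norm (r x)) (0) (atin X z)"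
      using tendsto_norm [OF lim(1)] rs [OF z True] by simp
    ultimately have "tendsto (\<lambda>x. r x * (u x / s x)) (0) (atin X z)"
      by (rule Lim_null_comparison)
    with True show ?thesis by simp
  qed
qed

lemma continuous_map_compose_real:
  assumes "continuous_on T h" "continuous_map X euclideanreal f" "f \<in> topspace X \<rightarrow> T"
  shows "continuous_map X euclideanreal (\<lambda>x. h (f x))"
proof -
  have "continuous_map X (top_of_set T) f"
    using assms by (simp add: continuous_map_in_subtopology image_subset_iff_funcset)
  then show ?thesis
    using continuous_map_compose [of X "top_of_set T" f euclideanreal h] assms(1)
    by (simp add: o_def)
qed

lemma continuous_map_sin:
  "continuous_map X euclideanreal f \<Longrightarrow> continuous_map X euclideanreal (\<lambda>x. sin (f x))"
  by (rule continuous_map_compose_real [of UNIV sin]) (auto intro: continuous_intros)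

lemma continuous_map_cos:
  "continuous_map X euclideanreal f \<Longrightarrow> continuous_map X euclideanreal (\<lambda>x. cos (f x))"
  by (rule continuous_map_compose_real [of UNIV cos]) (auto intro: continuous_intros)

lemma continuous_map_arccos_nsphere:
  assumes g: "continuous_map X (nsphere p) g"
  shows "continuous_map X euclideanreal (\<lambda>z. arccos (g z 0))"
proof (rule continuous_map_compose_real [OF continuous_on_arccos'])
  show "continuous_map X euclideanreal (\<lambda>z. g z 0)"
    using continuous_map_compose [OF g continuous_map_nsphere_projection] by (simp add: o_def)
  show "(\<lambda>z. g z 0) \<in> topspace X \<rightarrow> {-1..1}"
    using continuous_map_image_subset_topspace [OF g] nsphere_abs_le_1 [of _ p 0]
    by (fastforce simp: abs_le_iff)
qed

text \<open>Off the poles the quotients \<open>x i / sin (arccos (x 0))\<close> with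
  \<open>i > 0\<close> have square sum 1. At the poles they are 0, and \<open>cos a\<close> is 1 or
  -1.\<close>

lemma polar_in_nsphere:
  assumes x: "x \<in> topspace (nsphere p)" and a: "sin (arccos (x 0)) = 0 \<Longrightarrow> sin a = 0"
  shows "polar a x \<in> topspace (nsphere p)"
proof -
  let ?s = "sin (arccos (x 0))"
  have s: "?s\<^sup>2 = 1 - (x 0)\<^sup>2"
    using nsphere_abs_le_1 [OF x, of 0] by (simp add: sin_arccos_abs abs_square_le_1)
  have split: "(\<Sum>i\<le>p. w i) = w 0 + (\<Sum>i\<in>{..p} - {0}. w i)" for w :: "nat \<Rightarrow> real"
    by (rule sum.remove) auto
  have sumx: "(\<Sum>i\<in>{..p} - {0}. (x i)\<^sup>2) = ?s\<^sup>2"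
    using x split [of "\<lambda>i. (x i)\<^sup>2"] by (simp add: topspace_nsphere s)
  have "(\<Sum>i\<le>p. (polar a x i)\<^sup>2) = (cos a)\<^sup>2 + (\<Sum>i\<in>{..p} - {0}. (sin a / ?s)\<^sup>2 * (x i)\<^sup>2)"
    by (simp add: split) (simp add: polar_def power_mult_distrib power_divide)
  also have "\<dots> = (cos a)\<^sup>2 + (sin a / ?s)\<^sup>2 * ?s\<^sup>2"
    by (simp only: sum_distrib_left [symmetric] sumx)
  also have "\<dots> = 1"
    using a sin_cos_squared_add [of a] by (cases "?s = 0") (simp_all add: power_divide add.commute)
  finally show ?thesis
    using x by (simp add: topspace_nsphere polar_def)
qed

text \<open>Angle and point both vary with a parameter, so that \<open>X\<close> can be the product
  of an interval and the sphere.\<close>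

lemma continuous_map_polar:
  assumes g: "continuous_map X (nsphere p) g" and a: "continuous_map X euclideanreal a"
    and poles: "\<And>z. z \<in> topspace X \<Longrightarrow> sin (arccos (g z 0)) = 0 \<Longrightarrow> sin (a z) = 0"
  shows "continuous_map X (nsphere p) (\<lambda>z. polar (a z) (g z))"
proof -
  have gX: "g z \<in> topspace (nsphere p)" if "z \<in> topspace X" for z
    using continuous_map_image_subset_topspace [OF g] that by auto
  have gi: "continuous_map X euclideanreal (\<lambda>z. g z i)" for i
    using continuous_map_compose [OF g continuous_map_nsphere_projection] by (simp add: o_def)
  have "continuous_map X euclideanreal (\<lambda>z. polar (a z) (g z) i)" for i
  proof (cases "i = 0")
    case True
    then show ?thesis using continuous_map_cos [OF a] by (simp add: polar_def)
  next
    case False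
    have "continuous_map X euclideanreal (\<lambda>z. sin (a z) * (g z i / sin (arccos (g z 0))))"
    proof (rule continuous_map_mult_divide_bounded)
      fix z assume "z \<in> topspace X"
      then show "\<bar>g z i\<bar> \<le> \<bar>sin (arccos (g z 0))\<bar>"
        using nsphere_abs_le_sin [OF gX False] by force
    qed (auto intro: continuous_map_sin a gi poles continuous_map_arccos_nsphere [OF g])
    with False show ?thesis by (simp add: polar_def)
  qed
  moreover have "polar (a z) (g z) \<in> topspace (nsphere p)" if "z \<in> topspace X" for z
    using polar_in_nsphere gX poles that by blast
  ultimately show ?thesis
    unfolding nsphere topspace_nsphere
    by (auto simp: continuous_map_in_subtopology continuous_map_componentwise_UNIV)
qed

definition polar_map :: "(real \<Rightarrow> real) \<Rightarrow> (nat \<Rightarrow> real) \<Rightarrow> nat \<Rightarrow> real" where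
  "polar_map \<phi> x = polar (\<phi> (arccos (x 0))) x"

text \<open>The angle functions are joined by straight lines. At a pole both have the same value, a
  multiple of \<open>pi\<close>, so the intermediate angles keep it and \<open>polar\<close> stays
  continuous there.\<close>

lemma homotopic_polar_map:
  assumes cont: "continuous_on {0..pi} \<phi>" "continuous_on {0..pi} \<psi>"
    and ends: "\<phi> 0 = of_int m * pi" "\<psi> 0 = of_int m * pi" "\<phi> pi = of_int l * pi" "\<psi> pi = of_int l * pi"
  shows "homotopic_with (\<lambda>x. True) (nsphere p) (nsphere p) (polar_map \<phi>) (polar_map \<psi>)"
proof -
  let ?X = "prod_topology (top_of_set {0..1::real}) (nsphere p)"
  let ?a = "\<lambda>z. (1 - fst z) * \<phi> (arccos (snd z 0)) + fst z * \<psi> (arccos (snd z 0))"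
  have snd: "continuous_map ?X (nsphere p) snd"
    by (rule continuous_map_snd)
  have fst: "continuous_map ?X euclideanreal fst"
    by (rule continuous_map_into_fulltopology [OF continuous_map_fst])
  have range: "arccos (x 0) \<in> {0..pi}" if "x \<in> topspace (nsphere p)" for x
    using nsphere_abs_le_1 [OF that, of 0] by (simp add: arccos_lbound arccos_ubound abs_le_iff)
  have comp: "continuous_map ?X euclideanreal (\<lambda>z. \<xi> (arccos (snd z 0)))" 
    if "continuous_on {0..pi} \<xi>" for \<xi>
    by (rule continuous_map_compose_real [OF that continuous_map_arccos_nsphere [OF snd]])
       (use range in auto)
  have "continuous_map ?X (nsphere p) (\<lambda>z. polar (?a z) (snd z))"
  proof (rule continuous_map_polar [OF snd])
    show "continuous_map ?X euclideanreal ?a"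
      by (intro continuous_intros fst comp cont)
    fix z assume z: "z \<in> topspace ?X" and "sin (arccos (snd z 0)) = 0"
    moreover have "arccos (snd z 0) \<in> {0..pi}"
      using z by (intro range) auto
    ultimately have "arccos (snd z 0) = 0 \<or> arccos (snd z 0) = pi"
      using sin_gt_zero [of "arccos (snd z 0)"] by (force simp: le_less)
    then have "\<exists>j::int. ?a z = of_int j * pi"
      using ends by (metis (no_types, opaque_lifting) add.commute diff_add_cancel distrib_right mult_1)
    then show "sin (?a z) = 0"
      by (auto simp: sin_zero_iff_int2)
  qed
  then show ?thesis
    by (subst homotopic_with, simp) (auto intro!: exI [where x = "\<lambda>z. polar (?a z) (snd z)"] simp: polar_map_def)
qed

section \<open>The antipodal map in odd dimension\<close>

text \<open>\<open>J\<close> is \<open>y\<close> turned by a right angle in each plane of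
  coordinates \<open>2 * k\<close> and \<open>2 * k + 1\<close>. Since \<open>p\<close> is odd,
  these planes exhaust the coordinates up to \<open>p\<close>, and the identity holds plane by
  plane.\<close>

lemma odd_nsphere_rotation:
  fixes y :: "nat \<Rightarrow> real"
  assumes "odd p"
  defines "J \<equiv> \<lambda>i. if even i then - y (Suc i) else y (i - 1)"
  shows "(\<Sum>i\<le>p. (c * y i + s * J i)\<^sup>2) = (c\<^sup>2 + s\<^sup>2) * (\<Sum>i\<le>p. (y i)\<^sup>2)"
proof -
  obtain m where p: "p = Suc (2 * m)"
    using assms(1) by (metis oddE Suc_eq_plus1)
  have J: "J (2 * k) = - y (Suc (2 * k))" "J (Suc (2 * k)) = y (2 * k)" for k
    by (simp_all add: J_def)
  have step: "(\<Sum>i\<le>Suc (2 * Suc k). f i) = (\<Sum>i\<le>Suc (2 * k). f i) + f (2 * Suc k) + f (Suc (2 * Suc k))"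
    for f :: "nat \<Rightarrow> real" and k
    by simp
  \<comment> \<open>\<open>A\<close> and \<open>B\<close> are the sums over the earlier planes,
    \<open>u\<close> and \<open>v\<close> the coordinates in the next one.\<close>
  have rot: "A + (c * u + s * - v)\<^sup>2 + (c * v + s * u)\<^sup>2 = (c\<^sup>2 + s\<^sup>2) * (B + u\<^sup>2 + v\<^sup>2)"
    if "A = (c\<^sup>2 + s\<^sup>2) * B" for A B u v :: real
    unfolding that by (simp add: power2_eq_square algebra_simps)
  show ?thesis
    unfolding p
  proof (induction m)
    case 0
    show ?case
      using J [of 0] rot [of 0 0 "y 0" "y 1"] by simp
  next
    case (Suc m)
    show ?case
      unfolding step J by (rule rot [OF Suc])
  qed
qed

lemma continuous_map_nsphere_minus: "continuous_map (nsphere p) (nsphere p) (\<lambda>x i. - x i)"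
proof -
  have "continuous_map (nsphere p) euclideanreal (\<lambda>x. - x i)" for i
    by (intro continuous_intros continuous_map_nsphere_projection)
  then show ?thesis
    unfolding nsphere
    by (auto simp: continuous_map_in_subtopology continuous_map_componentwise_UNIV)
qed

text \<open>Rotating all coordinate planes at once through \<open>pi * t\<close> leads from the
  identity at \<open>t = 0\<close> to the antipodal map at \<open>t = 1\<close>.\<close>

lemma Brouwer_degree2_antipodal:
  assumes "odd p"
  shows "Brouwer_degree2 p (\<lambda>x i. - x i) = 1"
proof -
  let ?X = "prod_topology (top_of_set {0..1::real}) (nsphere p)"
  define J where "J = (\<lambda>(y::nat \<Rightarrow> real) i. if even i then - y (Suc i) else y (i - 1))"
  let ?h = "\<lambda>z i. cos (pi * fst z) * snd z i + sin (pi * fst z) * J (snd z) i"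
  have fst: "continuous_map ?X euclideanreal (\<lambda>z. pi * fst z)"
    by (intro continuous_intros continuous_map_into_fulltopology [OF continuous_map_fst])
  note sc = continuous_map_sin [OF fst] continuous_map_cos [OF fst]
  have snd: "continuous_map ?X euclideanreal (\<lambda>z. snd z i)" for i
    using continuous_map_compose [OF continuous_map_snd continuous_map_nsphere_projection] by (simp add: o_def)
  have "continuous_map ?X euclideanreal (\<lambda>z. J (snd z) i)" for i
    by (cases "even i") (auto simp: J_def intro: snd)
  then have "continuous_map ?X euclideanreal (\<lambda>z. ?h z i)" for i
    by (intro continuous_intros sc snd)
  moreover have "?h z \<in> topspace (nsphere p)" if "snd z \<in> topspace (nsphere p)" for z
  proof -
    have "(\<Sum>i\<le>p. (?h z i)\<^sup>2) = 1"
      using that by (simp add: J_def odd_nsphere_rotation [OF assms] topspace_nsphere)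
    moreover have "?h z i = 0" if "i > p" for i
    proof -
      \<comment> \<open>At an odd index \<open>J\<close> reads the preceding coordinate. The only
        index above \<open>p\<close> whose predecessor is not above \<open>p\<close> is
        \<open>p + 1\<close>, which is even, so only zeros are read.\<close>
      have "\<not> p < i - 1 \<Longrightarrow> even i"
        using that assms by (metis Suc_pred' even_Suc gr_zeroI less_antisym linorder_neqE_nat not_less_zero)
      with that \<open>snd z \<in> _\<close> show ?thesis
        by (auto simp: J_def topspace_nsphere)
    qed
    ultimately show ?thesis
      by (simp add: topspace_nsphere)
  qed
  ultimately have "continuous_map ?X (nsphere p) ?h"
    unfolding nsphere topspace_nsphere
    by (auto simp: continuous_map_in_subtopology continuous_map_componentwise_UNIV nsphere)
  then have "homotopic_with (\<lambda>x. True) (nsphere p) (nsphere p) id (\<lambda>x i. - x i)"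
    by (subst homotopic_with, simp) (auto intro!: exI [where x = ?h])
  then show ?thesis
    using Brouwer_degree2_homotopic by fastforce
qed

section \<open>Degrees of polar maps\<close>

text \<open>The poles are no exception: the other coordinates of \<open>x\<close> are 0 there, as is
  the result of the division by 0.\<close>

lemma polar_map_id:
  assumes x: "x \<in> topspace (nsphere p)"
  shows "polar_map (\<lambda>\<theta>. \<theta>) x = x"
proof
  fix i
  show "polar_map (\<lambda>\<theta>. \<theta>) x i = x i"
    using nsphere_abs_le_1 [OF x, of 0] nsphere_abs_le_sin [OF x, of i]
    by (cases "sin (arccos (x 0)) = 0") (auto simp: polar_map_def polar_def cos_arccos_abs)
qed

text \<open>At a multiple of \<open>pi\<close> the dependence on \<open>x\<close> disappears. This
  yields the point to which the equator is pinched, and the constant map in the case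
  \<open>k = 0\<close>.\<close>

lemma polar_int_pi: "polar (of_int m * pi) x = (\<lambda>i. if i = 0 then cos (of_int m * pi) else 0)"
  by (auto simp: polar_def fun_eq_iff sin_zero_iff_int2)

lemma polar_add_pi: "polar (a + pi) x = (\<lambda>i. - polar a x i)"
  by (auto simp: polar_def)

text \<open>The chosen representative of the angle functions with values \<open>m * pi\<close> and
  \<open>l * pi\<close> at the poles; \<open>linear_angle 0 k\<close> is multiplication by
  \<open>k\<close>.\<close>

definition linear_angle :: "int \<Rightarrow> int \<Rightarrow> real \<Rightarrow> real" where
  "linear_angle m l \<theta> = of_int m * pi + of_int (l - m) * \<theta>"

lemma linear_angle_ends:
  "linear_angle m l 0 = of_int m * pi" "linear_angle m l pi = of_int l * pi"
  by (simp_all add: linear_angle_def algebra_simps)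

lemma continuous_on_linear_angle: "continuous_on S (linear_angle m l)"
  unfolding linear_angle_def by (intro continuous_intros)

lemma continuous_map_polar_map:
  assumes "continuous_on {0..pi} \<phi>" "\<phi> 0 = of_int m * pi" "\<phi> pi = of_int l * pi"
  shows "continuous_map (nsphere p) (nsphere p) (polar_map \<phi>)"
  \<comment> \<open>Continuity is read off from the homotopy of \<open>polar_map \<phi>\<close> to
    itself.\<close>
  using homotopic_polar_map [OF assms(1,1,2,2,3,3)] homotopic_with_imp_continuous_maps by blast

lemma Brouwer_degree2_polar_map:
  assumes "continuous_on {0..pi} \<phi>" "\<phi> 0 = of_int m * pi" "\<phi> pi = of_int l * pi"
  shows "Brouwer_degree2 p (polar_map \<phi>) = Brouwer_degree2 p (polar_map (linear_angle m l))"
  by (intro Brouwer_degree2_homotopic homotopic_polar_map [where m = m and l = l] assms continuous_on_linear_angle linear_angle_ends)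

lemma Brouwer_degree2_linear_angle_split:
  "Brouwer_degree2 p (polar_map (linear_angle m l)) =
   Brouwer_degree2 p (polar_map (linear_angle m j)) + Brouwer_degree2 p (polar_map (linear_angle j l))"
proof -
  \<comment> \<open>\<open>\<phi>\<close> runs from \<open>m * pi\<close> to \<open>j * pi\<close>
    on the upper hemisphere and then rests; \<open>\<psi>\<close> rests at \<open>j * pi\<close> and
    runs to \<open>l * pi\<close> on the lower one. At each angle one of them equals
    \<open>j * pi\<close>, so \<open>\<eta>\<close> follows the other.\<close>
  define \<phi> where "\<phi> = (\<lambda>\<theta>. of_int m * pi + of_int (j - m) * min (2 * \<theta>) pi)"
  define \<psi> where "\<psi> = (\<lambda>\<theta>. of_int j * pi + of_int (l - j) * max (2 * \<theta> - pi) 0)"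
  define \<eta> where "\<eta> = (\<lambda>\<theta>. \<phi> \<theta> + \<psi> \<theta> - of_int j * pi)"
  have cont: "continuous_on {0..pi} \<phi>" "continuous_on {0..pi} \<psi>" "continuous_on {0..pi} \<eta>"
    unfolding \<eta>_def \<phi>_def \<psi>_def by (intro continuous_intros)+
  have ends: "\<phi> 0 = of_int m * pi" "\<phi> pi = of_int j * pi" "\<psi> 0 = of_int j * pi"
    "\<psi> pi = of_int l * pi" "\<eta> 0 = of_int m * pi" "\<eta> pi = of_int l * pi"
    by (simp_all add: \<eta>_def \<phi>_def \<psi>_def min_def max_def algebra_simps)
  have upper: "\<psi> (arccos (x 0)) = of_int j * pi" if "x \<in> topspace (nsphere p)" "x 0 \<ge> 0" for x
    using nsphere_abs_le_1 [OF that(1), of 0] arccos_le_pi2 [of "x 0"] that(2)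
    by (simp add: \<psi>_def max_def)
  have lower: "\<phi> (arccos (x 0)) = of_int j * pi" if "x \<in> topspace (nsphere p)" "x 0 \<le> 0" for x
    using nsphere_abs_le_1 [OF that(1), of 0] arccos_le_arccos [of "x 0" 0] that(2)
    by (simp add: \<phi>_def min_def algebra_simps)
  let ?a = "\<lambda>i::nat. if i = 0 then cos (of_int j * pi) else 0"
  have "Brouwer_degree2 p (polar_map \<eta>) = Brouwer_degree2 p (polar_map \<phi>) + Brouwer_degree2 p (polar_map \<psi>)"
  proof (rule Brouwer_degree2_pinch [where k = 0 and a = ?a])
    fix x assume x: "x \<in> topspace (nsphere p)"
    show "polar_map \<eta> x = polar_map \<phi> x" if "0 \<le> x 0"
      using upper [OF x that] by (simp add: polar_map_def \<eta>_def)
    show "polar_map \<eta> x = polar_map \<psi> x" if "x 0 \<le> 0"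
      using lower [OF x that] by (simp add: polar_map_def \<eta>_def)
    show "polar_map \<phi> x = ?a" if "x 0 \<le> 0"
      using lower [OF x that] by (simp add: polar_map_def polar_int_pi)
    show "polar_map \<psi> x = ?a" if "0 \<le> x 0"
      using upper [OF x that] by (simp add: polar_map_def polar_int_pi)
  next
    have "sin (of_int j * pi) = 0"
      by (auto simp: sin_zero_iff_int2)
    then show "?a \<in> topspace (nsphere p)"
      using polar_in_nsphere [OF in_topspace_nsphere, of "of_int j * pi"] by (simp add: polar_int_pi)
  qed (rule continuous_map_polar_map; fact cont ends)+
  then show ?thesis
    using Brouwer_degree2_polar_map [OF cont(1) ends(1,2)] Brouwer_degree2_polar_map [OF cont(2) ends(3,4)]
      Brouwer_degree2_polar_map [OF cont(3) ends(5,6)] by metis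
qed

lemma Brouwer_degree2_linear_angle_shift:
  assumes "odd p"
  shows "Brouwer_degree2 p (polar_map (linear_angle (m + 1) (l + 1))) =
         Brouwer_degree2 p (polar_map (linear_angle m l))"
proof -
  have "linear_angle (m + 1) (l + 1) \<theta> = linear_angle m l \<theta> + pi" for \<theta>
    by (simp add: linear_angle_def algebra_simps)
  then have "polar_map (linear_angle (m + 1) (l + 1)) = (\<lambda>x i. - x i) \<circ> polar_map (linear_angle m l)"
    by (simp add: fun_eq_iff polar_map_def polar_add_pi)
  then show ?thesis
    by (simp add: Brouwer_degree2_compose Brouwer_degree2_antipodal [OF assms] continuous_map_nsphere_minus
        continuous_map_polar_map [OF continuous_on_linear_angle linear_angle_ends])
qed

lemma Brouwer_degree2_linear_angle:
  assumes "odd p"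
  shows "Brouwer_degree2 p (polar_map (linear_angle 0 k)) = k"
proof -
  let ?D = "\<lambda>m l. Brouwer_degree2 p (polar_map (linear_angle m l))"
  have "linear_angle 0 1 = (\<lambda>\<theta>. \<theta>)"
    by (simp add: linear_angle_def fun_eq_iff)
  then have "?D 0 1 = Brouwer_degree2 p id"
    by (intro Brouwer_degree2_eq) (simp add: polar_map_id)
  then have step: "?D 0 (j + 1) = 1 + ?D 0 j" for j
    using Brouwer_degree2_linear_angle_split [of p 0 "j + 1" 1]
      Brouwer_degree2_linear_angle_shift [OF assms, of 0 j] by simp
  show ?thesis
  proof (induction k rule: int_induct [where k = 0])
    case base
    have "polar_map (linear_angle 0 0) = (\<lambda>x i. if i = 0 then cos (of_int 0 * pi) else 0)"
      using polar_int_pi [of 0] by (simp add: fun_eq_iff polar_map_def linear_angle_def)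
    then show ?case
      by (simp only: Brouwer_degree2_const)
  next
    case (step1 i)
    then show ?case by (simp add: step)
  next
    case (step2 i)
    \<comment> \<open>Read downwards, \<open>step\<close> reaches the negative integers.\<close>
    then show ?case using step [of "i - 1"] by simp
  qed
qed

subsection \<open>Powers in the Cayley-Dickson algebras\<close>

lemma cd_fst_linear: "cd_fst n (\<lambda>i. a * u i + b * v i) = (\<lambda>i. a * cd_fst n u i + b * cd_fst n v i)"
  and cd_snd_linear: "cd_snd n (\<lambda>i. a * u i + b * v i) = (\<lambda>i. a * cd_snd n u i + b * cd_snd n v i)"
  by (auto simp: cd_fst_def cd_snd_def)

lemma cd_conj_linear:
  "cd_conj n (\<lambda>i. a * u i + b * v i) = (\<lambda>i. a * cd_conj n u i + b * cd_conj n v i)"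
proof (induction n arbitrary: u v)
  case (Suc n)
  show ?case
    by (simp add: Suc cd_fst_linear cd_snd_linear, simp add: cd_pair_def fun_eq_iff algebra_simps)
qed simp

text \<open>The two slots need a joint induction, because the recursion also places components of
  the left factor on the right and conversely.\<close>

lemma cd_mult_linear:
  "cd_mult n (\<lambda>i. a * u i + b * v i) w = (\<lambda>i. a * cd_mult n u w i + b * cd_mult n v w i) \<and>
   cd_mult n w (\<lambda>i. a * u i + b * v i) = (\<lambda>i. a * cd_mult n w u i + b * cd_mult n w v i)"
proof (induction n arbitrary: u v w)
  case 0
  show ?case by (simp add: fun_eq_iff algebra_simps)
next
  case (Suc n)
  show ?case
    by (simp add: Suc Let_def cd_fst_linear cd_snd_linear cd_conj_linear,
        simp add: cd_pair_def fun_eq_iff algebra_simps)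
qed

lemmas cd_mult_linear_left = cd_mult_linear [THEN conjunct1]
lemmas cd_mult_linear_right = cd_mult_linear [THEN conjunct2]

text \<open>The support condition matters: \<open>cd_conj 0\<close> changes no entry and
  \<open>cd_pair\<close> truncates, whereas the right side negates every entry but the
  first.\<close>

lemma cd_conj_eq:
  assumes "\<forall>i\<ge>2 ^ n. x i = 0"
  shows "cd_conj n x = (\<lambda>i. if i = 0 then x 0 else - x i)"
  using assms
proof (induction n arbitrary: x)
  case 0
  then show ?case by (auto simp: fun_eq_iff)
next
  case (Suc n)
  have "cd_conj n (cd_fst n x) = (\<lambda>i. if i = 0 then cd_fst n x 0 else - cd_fst n x i)"
    by (rule Suc.IH) (simp add: cd_fst_def)
  with Suc.prems show ?case
    by (auto simp: fun_eq_iff cd_pair_def cd_fst_def cd_snd_def)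
qed

lemma cd_mult_zero: "cd_mult n (\<lambda>i. 0) w = (\<lambda>i. 0)" "cd_mult n w (\<lambda>i. 0) = (\<lambda>i. 0)"
  using cd_mult_linear_left [of n 0 w 0 w w] cd_mult_linear_right [of n w 0 w 0 w] by simp_all

lemma cd_fst_one: "cd_fst n cd_one = cd_one"
  and cd_snd_one: "cd_snd n cd_one = (\<lambda>i. 0)"
  by (auto simp: cd_fst_def cd_snd_def cd_one_def)

lemma cd_conj_one: "cd_conj n cd_one = cd_one"
  by (subst cd_conj_eq) (auto simp: cd_one_def fun_eq_iff not_le)

lemma cd_conj_zero: "cd_conj n (\<lambda>i. 0) = (\<lambda>i. 0)"
  by (subst cd_conj_eq) auto

lemma cd_mult_one:
  assumes "\<forall>i\<ge>2 ^ n. x i = 0"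
  shows "cd_mult n cd_one x = x \<and> cd_mult n x cd_one = x"
  using assms
proof (induction n arbitrary: x)
  case 0
  then show ?case by (auto simp: cd_one_def fun_eq_iff)
next
  case (Suc n)
  have fst: "cd_mult n cd_one (cd_fst n x) = cd_fst n x \<and> cd_mult n (cd_fst n x) cd_one = cd_fst n x"
    by (rule Suc.IH) (simp add: cd_fst_def)
  have snd: "cd_mult n cd_one (cd_snd n x) = cd_snd n x \<and> cd_mult n (cd_snd n x) cd_one = cd_snd n x"
    by (rule Suc.IH) (simp add: cd_snd_def)
  have "cd_pair n (cd_fst n x) (cd_snd n x) = x"
    using Suc.prems by (auto simp: cd_pair_def cd_fst_def cd_snd_def fun_eq_iff)
  with fst snd show ?case
    by (simp add: Let_def cd_fst_one cd_snd_one cd_mult_zero cd_conj_one cd_conj_zero)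
qed

text \<open>In this form bilinearity reduces products with a conjugate to products with
  \<open>x\<close> and with the unit.\<close>

lemma cd_conj_eq_linear:
  assumes "\<forall>i\<ge>2 ^ n. x i = 0"
  shows "cd_conj n x = (\<lambda>i. (2 * x 0) * cd_one i + (-1) * x i)"
  by (subst cd_conj_eq [OF assms]) (auto simp: cd_one_def)

lemma sum_power2_cd_fst_snd:
  "(\<Sum>j<2 ^ Suc n. (x j)\<^sup>2) = (\<Sum>j<2 ^ n. (cd_fst n x j)\<^sup>2) + (\<Sum>j<2 ^ n. (cd_snd n x j)\<^sup>2)"
proof -
  have "(\<Sum>j<2 ^ n + 2 ^ n. (x j)\<^sup>2) = (\<Sum>j<2 ^ n. (x j)\<^sup>2) + (\<Sum>j<2 ^ n. (x (2 ^ n + j))\<^sup>2)"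
    using sum.atLeastLessThan_concat [of 0 "2 ^ n" "2 ^ n + 2 ^ n" "\<lambda>j. (x j)\<^sup>2"]
      sum.shift_bounds_nat_ivl [of "\<lambda>j. (x j)\<^sup>2" 0 "2 ^ n" "2 ^ n"]
    by (simp add: atLeast0LessThan add.commute)
  then show ?thesis
    by (simp add: cd_fst_def cd_snd_def mult_2)
qed

text \<open>For x = (a, b) the components are aa - conj(b) b and ba + b conj(a). Since conj(b) = 2
  Re(b) e0 - b, the induction hypothesis for b gives conj(b) b = |b|^2 e0; since a + conj(a) = 2
  Re(a) e0, the second component is 2 Re(a) b. This quadratic relation stands in for associativity
  when powers are computed.\<close>

lemma cd_mult_self:
  assumes "\<forall>i\<ge>2 ^ n. x i = 0"
  shows "cd_mult n x x = (\<lambda>i. (2 * x 0) * x i + - (\<Sum>j<2 ^ n. (x j)\<^sup>2) * cd_one i)"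
  using assms
proof (induction n arbitrary: x)
  case 0
  then show ?case by (auto simp: cd_one_def fun_eq_iff power2_eq_square)
next
  case (Suc n)
  let ?a = "cd_fst n x" and ?b = "cd_snd n x"
  have a0: "\<forall>i\<ge>2 ^ n. ?a i = 0" and b0: "\<forall>i\<ge>2 ^ n. ?b i = 0"
    by (simp_all add: cd_fst_def cd_snd_def)
  have x0: "?a 0 = x 0"
    by (simp add: cd_fst_def)
  have "cd_mult (Suc n) x x = cd_pair n
      (\<lambda>i. (2 * x 0) * ?a i - (\<Sum>j<2 ^ Suc n. (x j)\<^sup>2) * cd_one i) (\<lambda>i. (2 * x 0) * ?b i)"
    unfolding cd_mult.simps Let_def cd_conj_eq_linear [OF a0] cd_conj_eq_linear [OF b0]
      cd_mult_linear_left cd_mult_linear_right sum_power2_cd_fst_snd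
    by (simp add: Suc.IH [OF a0] Suc.IH [OF b0] cd_mult_one [OF b0] x0)
       (simp add: algebra_simps)
  with Suc.prems show ?case
    by (auto simp: fun_eq_iff cd_pair_def cd_fst_def cd_snd_def cd_one_def)
qed

section \<open>Powers on the sphere as polar maps\<close>

lemma cd_pow_eq_polar:
  assumes x: "x \<in> topspace (cd_sphere n)"
  shows "cd_pow n x m = polar (real m * arccos (x 0)) x"
proof -
  define t where "t = arccos (x 0)"
  have p: "{..2 ^ n - 1} = {..<2 ^ n::nat}"
    by (metis Suc_pred' lessThan_Suc_atMost pos2 zero_less_power)
  have supp: "\<forall>i\<ge>2 ^ n. x i = 0"
    using x unfolding topspace_cd_sphere topspace_Euclidean_space by auto
  have sum1: "(\<Sum>j<2 ^ n. (x j)\<^sup>2) = 1"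
    using x unfolding topspace_nsphere p by auto
  have x0: "x 0 = cos t"
    using nsphere_abs_le_1 [OF x, of 0] by (simp add: t_def cos_arccos_abs)
  show ?thesis
  proof (cases "sin t = 0")
    case False
    \<comment> \<open>\<open>A s\<close> and \<open>B s\<close> are the coordinates of
      \<open>polar s x\<close> with respect to \<open>cd_one\<close> and \<open>x\<close>. By the
      quadratic relation, multiplication by \<open>x\<close> sends (A, B) to (-B, A + 2 (x 0) B),
      which the addition formulas identify with the coordinates at \<open>s + t\<close>.\<close>
    define A where "A = (\<lambda>s. cos s - cos t * sin s / sin t)"
    define B where "B = (\<lambda>s. sin s / sin t)"
    have pol: "polar s x = (\<lambda>i. A s * cd_one i + B s * x i)" for s
      using False by (auto simp: polar_def fun_eq_iff A_def B_def cd_one_def simp flip: t_def)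
        (simp_all add: x0)
    show ?thesis
      unfolding t_def [symmetric]
    proof (induction m)
      case 0
      show ?case by (simp add: polar_def cd_one_def fun_eq_iff)
    next
      case (Suc m)
      let ?s = "real m * t"
      have "A (?s + t) * sin t = sin t * cos (?s + t) - cos t * sin (?s + t)"
        using False by (simp add: A_def left_diff_distrib)
      also have "\<dots> = - sin ?s"
        by (simp flip: sin_diff)
      finally have "A (?s + t) = - B ?s"
        using False by (metis B_def minus_divide_left nonzero_eq_divide_eq)
      moreover have "B (?s + t) = A ?s + 2 * x 0 * B ?s"
        using False by (simp add: A_def B_def x0 sin_add field_simps)
      moreover have "real (Suc m) * t = ?s + t"
        by (simp add: algebra_simps)
      moreover have "cd_pow n x (Suc m) = (\<lambda>i. - B ?s * cd_one i + (A ?s + 2 * x 0 * B ?s) * x i)"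
        unfolding cd_pow.simps Suc pol cd_mult_linear_left cd_mult_self [OF supp] sum1
        by (simp add: cd_mult_one [OF supp] algebra_simps)
      ultimately show ?case
        unfolding pol by simp
    qed
  next
    case True
    have xi: "x i = 0" if "i \<noteq> 0" for i
      using nsphere_abs_le_sin [OF x that] True by (simp add: t_def)
    have xone: "x = (\<lambda>i. cos t * cd_one i + 0 * x i)"
      using xi x0 by (auto simp: cd_one_def fun_eq_iff)
    \<comment> \<open>At the poles \<open>x\<close> is plus or minus the unit. The summand
      \<open>0 * x i\<close> gives the shape that \<open>cd_mult_linear_left\<close>
      rewrites.\<close>
    have pol: "polar s x = (\<lambda>i. cos s * cd_one i + 0 * x i)" for s
      using xi by (auto simp: polar_def cd_one_def fun_eq_iff)
    show ?thesis
      unfolding t_def [symmetric]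
    proof (induction m)
      case 0
      show ?case by (simp add: polar_def cd_one_def fun_eq_iff)
    next
      case (Suc m)
      have "cd_pow n x (Suc m) = (\<lambda>i. cos (real m * t) * x i)"
        unfolding cd_pow.simps Suc pol cd_mult_linear_left
        by (simp add: cd_mult_one [OF supp])
      also have "\<dots> = polar (real m * t + t) x"
        unfolding pol by (subst xone) (simp add: cos_add True mult.assoc)
      finally show ?case
        by (simp add: algebra_simps)
    qed
  qed
qed

lemma cd_rho_eq_polar:
  assumes x: "x \<in> topspace (cd_sphere n)"
  shows "cd_rho n k x = polar (of_int k * arccos (x 0)) x"
proof (cases "k \<ge> 0")
  case True
  then show ?thesis
    by (simp add: cd_rho_def cd_power_int_def cd_pow_eq_polar [OF x])
next
  case False
  \<comment> \<open>On the sphere the inverse is the conjugate \<open>y\<close>, which has the polar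
    angle of \<open>x\<close> and the opposite direction. Reversing the direction amounts to
    negating the angle passed to \<open>polar\<close>.\<close>
  define y where "y = (\<lambda>i. if i = 0 then x 0 else - x i)"
  have "cd_norm n x = 1" "\<forall>i\<ge>2 ^ n. x i = 0"
    using x unfolding topspace_cd_sphere topspace_Euclidean_space by auto
  then have "cd_inverse n x = y"
    by (simp add: cd_inverse_def cd_conj_eq y_def)
  moreover have "y \<in> topspace (cd_sphere n)"
  proof -
    have "(y i)\<^sup>2 = (x i)\<^sup>2" for i by (simp add: y_def)
    with x show ?thesis by (simp add: topspace_nsphere) (simp add: y_def)
  qed
  ultimately show ?thesis
    using False
    by (simp add: cd_rho_def cd_power_int_def cd_pow_eq_polar, simp add: y_def polar_def fun_eq_iff)
qed

theorem theorem2p3: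
  fixes n :: nat and k :: int
  assumes "n \<ge> 1"
  shows "continuous_map (cd_sphere n) (cd_sphere n) (cd_rho n k) \<and>
         Brouwer_degree2 (2 ^ n - 1) (cd_rho n k) = k"
proof -
  have eq: "polar_map (linear_angle 0 k) x = cd_rho n k x" if "x \<in> topspace (cd_sphere n)" for x
    using cd_rho_eq_polar [OF that] by (simp add: polar_map_def linear_angle_def)
  \<comment> \<open>Here \<open>n \<ge> 1\<close> enters: for \<open>n = 0\<close> the dimension
    would be 0.\<close>
  have "odd (2 ^ n - 1 :: nat)"
    using assms by simp
  have "Brouwer_degree2 (2 ^ n - 1) (cd_rho n k) =
        Brouwer_degree2 (2 ^ n - 1) (polar_map (linear_angle 0 k))"
    by (rule Brouwer_degree2_eq [symmetric]) (rule eq)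
  also have "\<dots> = k"
    by (rule Brouwer_degree2_linear_angle) fact
  finally have "Brouwer_degree2 (2 ^ n - 1) (cd_rho n k) = k" .
  moreover have "continuous_map (cd_sphere n) (cd_sphere n) (cd_rho n k)"
    by (rule continuous_map_eq [OF continuous_map_polar_map eq])
       (rule continuous_on_linear_angle linear_angle_ends)+
  ultimately show ?thesis by blast
qed

end
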